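(* Let $k$ be an algebraically closed field and let $A$ be a $k$-algebra. If there exists a finite-dimensional filtration $V=\{V_n : n\in\mathbb{N}\}$ on $A$ such that the associated graded algebra $\mathrm{gr}_V(A)$ is a (not necessarily commutative) domain, then $A$ is a finite factorization domain.
   Context: $\mathbb{N}$ includes $0$. Algebras are associative and unital, not necessarily commutative. A filtration on a $k$-algebra $A$ is a family $V=\{V_n : n\in\mathbb{N}\}$ of $k$-subspaces with $A=\bigcup_n V_n$, $V_n\subseteq V_m$ whenever $n\le m$, and $V_nV_m\subseteq V_{n+m}$ for all $n,m\ge 0$. It is finite-dimensional if each $V_n$ is a finite-dimensional $k$-vector space. The associated graded algebra is $\mathrm{gr}_V(A)=\bigoplus_{n\ge 0}V_n/V_{n-1}$ with $V_{-1}=\{0\}$, with the multiplication induced from $A$. A (not necessarily commutative) domain $A$ is a finite factorization domain (FFD) if every nonzero non-unit element of $A$ has at least one factorization $a=a_1\cdots a_m$ into irreducible elements (nonzero non-units that are not a product of two non-units) and at most finitely many distinct such factorizations up to multiplication of the irreducible factors by central units of $A$. (Factorizations are ordered sequences of factors.) *)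

theory Defs
  imports
    "HOL-Algebra.Ring"
    "HOL-Computational_Algebra.Polynomial"
    "HOL-Computational_Algebra.Formal_Power_Series"
begin

section \<open>Algebras and filtrations\<close>

locale k_algebra = vector_space scale
  for scale :: "'k::field \<Rightarrow> 'a::ring_1 \<Rightarrow> 'a" +
  assumes scale_mult_left: "scale c x * y = scale c (x * y)"
    and scale_mult_right: "x * scale c y = scale c (x * y)"

text \<open>As in the source, \<open>1 \<in> V 0\<close> is not part of the notion of a filtration.\<close>

definition filtration :: "('k::field \<Rightarrow> 'a::ring_1 \<Rightarrow> 'a) \<Rightarrow> (nat \<Rightarrow> 'a set) \<Rightarrow> bool" where
  "filtration scale V \<longleftrightarrow>
     (\<forall>n. module.subspace scale (V n)) \<and>
     (\<Union>n. V n) = UNIV \<and>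
     (\<forall>n m. n \<le> m \<longrightarrow> V n \<subseteq> V m) \<and>
     (\<forall>n m. \<forall>x\<in>V n. \<forall>y\<in>V m. x * y \<in> V (n + m))"

definition finite_dim_filtration ::
    "('k::field \<Rightarrow> 'a::ring_1 \<Rightarrow> 'a) \<Rightarrow> (nat \<Rightarrow> 'a set) \<Rightarrow> bool" where
  "finite_dim_filtration scale V \<longleftrightarrow>
     filtration scale V \<and> (\<forall>n. \<exists>B. finite B \<and> V n = module.span scale B)"

section \<open>The associated graded ring\<close>

definition V_pred :: "(nat \<Rightarrow> 'a::ring_1 set) \<Rightarrow> nat \<Rightarrow> 'a set" where
  "V_pred V n = (if n = 0 then {0} else V (n - 1))"

definition gr_class :: "(nat \<Rightarrow> 'a::ring_1 set) \<Rightarrow> nat \<Rightarrow> 'a \<Rightarrow> 'a set" where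
  "gr_class V n x = (\<lambda>w. x + w) ` V_pred V n"

text \<open>An element of the direct sum of the quotients \<open>V n / V (n - 1)\<close> is the sequence of its
  homogeneous components, each one a coset of \<open>V (n - 1)\<close> in \<open>V n\<close>, all but finitely many being
  the zero coset. The component of degree \<open>n\<close> of a product is
  the coset modulo \<open>V (n - 1)\<close> of the sum of \<open>x\<^sub>i y\<^sub>j\<close> over \<open>i + j = n\<close>, for representatives
  \<open>x\<^sub>i\<close>, \<open>y\<^sub>j\<close> of the components of the factors; the definition ranges over all choices of
  representatives, and \<open>gr_lift_mult\<close> below shows that they yield one and the same coset.
  Only the ring structure is recorded: the action of the field is irrelevant to being a domain.\<close>

definition assoc_graded :: "(nat \<Rightarrow> 'a::ring_1 set) \<Rightarrow> (nat \<Rightarrow> 'a set) ring" where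
  "assoc_graded V = \<lparr>
     carrier = {f. (\<forall>n. \<exists>x\<in>V n. f n = gr_class V n x) \<and> finite {n. f n \<noteq> V_pred V n}},
     monoid.mult = (\<lambda>f g n. {(\<Sum>i\<le>n. x i * y (n - i)) + w | x y w.
                        (\<forall>i. x i \<in> f i) \<and> (\<forall>j. y j \<in> g j) \<and> w \<in> V_pred V n}),
     one = (\<lambda>n. gr_class V n (if n = 0 then 1 else 0)),
     ring.zero = (\<lambda>n. V_pred V n),
     add = (\<lambda>f g n. {x + y | x y. x \<in> f n \<and> y \<in> g n}) \<rparr>"

context
  fixes scale :: "'k::field \<Rightarrow> 'a::ring_1 \<Rightarrow> 'a" and V :: "nat \<Rightarrow> 'a set"
  assumes alg: "k_algebra scale" and filt: "filtration scale V"
begin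

interpretation k_algebra scale by (fact alg)

lemma filtration_subspace: "subspace (V n)"
  and filtration_mono: "n \<le> m \<Longrightarrow> V n \<subseteq> V m"
  and filtration_mult: "x \<in> V n \<Longrightarrow> y \<in> V m \<Longrightarrow> x * y \<in> V (n + m)"
  using filt by (auto simp: filtration_def)

lemma V_pred_subspace: "subspace (V_pred V n)"
  by (simp add: V_pred_def filtration_subspace subspace_single_0)

lemma V_pred_subset: "V_pred V n \<subseteq> V n"
  using filtration_mono[of "n - 1" n] subspace_0[OF filtration_subspace]
  by (auto simp: V_pred_def)

lemma V_pred_mult_left: "x \<in> V_pred V n \<Longrightarrow> y \<in> V m \<Longrightarrow> x * y \<in> V_pred V (n + m)"
  using filtration_mult[of x "n - 1" y m] subspace_0[OF V_pred_subspace, of "n + m"]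
  by (cases n) (auto simp: V_pred_def)

lemma V_pred_mult_right: "x \<in> V n \<Longrightarrow> y \<in> V_pred V m \<Longrightarrow> x * y \<in> V_pred V (n + m)"
  using filtration_mult[of x n y "m - 1"] subspace_0[OF V_pred_subspace, of "n + m"]
  by (cases m) (auto simp: V_pred_def)

lemma in_gr_class: "y \<in> gr_class V n x \<longleftrightarrow> y - x \<in> V_pred V n"
  by (auto simp: gr_class_def image_iff) (metis add.commute diff_add_cancel)

lemma gr_class_eq_iff: "gr_class V n x = gr_class V n y \<longleftrightarrow> x - y \<in> V_pred V n"
proof
  assume eq: "gr_class V n x = gr_class V n y"
  have "x \<in> gr_class V n x"
    using subspace_0[OF V_pred_subspace, of n] by (simp add: in_gr_class)
  then have "x \<in> gr_class V n y" by (simp only: eq)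
  then show "x - y \<in> V_pred V n" by (simp add: in_gr_class)
next
  assume xy: "x - y \<in> V_pred V n"
  have "z - x \<in> V_pred V n \<longleftrightarrow> z - y \<in> V_pred V n" for z
    using subspace_add[OF V_pred_subspace _ xy, of "z - x"]
      subspace_diff[OF V_pred_subspace _ xy, of "z - y"] by auto
  then show "gr_class V n x = gr_class V n y" by (auto simp: in_gr_class)
qed

lemma gr_class_0: "gr_class V n 0 = V_pred V n"
  by (simp add: gr_class_def)

text \<open>Elements of the graded ring are represented by power series with finite support, whose
  multiplication is the convolution used in \<^const>\<open>assoc_graded\<close>.\<close>

definition gr_lift :: "'a fps \<Rightarrow> nat \<Rightarrow> 'a set" where
  "gr_lift F n = gr_class V n (fps_nth F n)"

definition gr_reps :: "'a fps set" where
  "gr_reps = {F. (\<forall>n. fps_nth F n \<in> V n) \<and> finite {n. fps_nth F n \<noteq> 0}}"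

lemma carrier_assoc_graded: "carrier (assoc_graded V) = gr_lift ` gr_reps"
proof (intro Set.set_eqI iffI)
  fix f assume f: "f \<in> carrier (assoc_graded V)"
  then obtain x where x: "\<And>n. x n \<in> V n" "\<And>n. f n = gr_class V n (x n)"
    unfolding assoc_graded_def by simp metis
  define F where "F = Abs_fps (\<lambda>n. if f n = V_pred V n then 0 else x n)"
  have "gr_lift F n = f n" for n
    using x(2)[of n] by (simp add: gr_lift_def F_def gr_class_0)
  moreover have "F \<in> gr_reps"
  proof -
    have "{n. fps_nth F n \<noteq> 0} \<subseteq> {n. f n \<noteq> V_pred V n}" by (auto simp: F_def)
    moreover have "finite {n. f n \<noteq> V_pred V n}" using f by (simp add: assoc_graded_def)
    ultimately have "finite {n. fps_nth F n \<noteq> 0}" by (rule finite_subset)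
    with x(1) show ?thesis
      by (auto simp: gr_reps_def F_def subspace_0[OF filtration_subspace])
  qed
  ultimately show "f \<in> gr_lift ` gr_reps" by auto
next
  fix f assume "f \<in> gr_lift ` gr_reps"
  then obtain F where F: "F \<in> gr_reps" "f = gr_lift F" by auto
  have "{n. f n \<noteq> V_pred V n} \<subseteq> {n. fps_nth F n \<noteq> 0}"
    by (auto simp: F gr_lift_def gr_class_0)
  then have "finite {n. f n \<noteq> V_pred V n}"
    using F(1) by (auto simp: gr_reps_def intro: finite_subset)
  then show "f \<in> carrier (assoc_graded V)"
    using F by (auto simp: assoc_graded_def gr_lift_def gr_reps_def)
qed

lemma gr_lift_zero: "\<zero>\<^bsub>assoc_graded V\<^esub> = gr_lift 0"
  by (auto simp: assoc_graded_def gr_lift_def gr_class_0)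

lemma gr_lift_one: "\<one>\<^bsub>assoc_graded V\<^esub> = gr_lift 1"
  by (auto simp: assoc_graded_def gr_lift_def fun_eq_iff)

lemma gr_lift_add: "gr_lift F \<oplus>\<^bsub>assoc_graded V\<^esub> gr_lift G = gr_lift (F + G)"
proof
  fix n
  let ?a = "fps_nth F n" and ?b = "fps_nth G n"
  have "(\<exists>x y. z = x + y \<and> x - ?a \<in> V_pred V n \<and> y - ?b \<in> V_pred V n) \<longleftrightarrow>
        z - (?a + ?b) \<in> V_pred V n" for z
  proof safe
    fix x y assume "x - ?a \<in> V_pred V n" "y - ?b \<in> V_pred V n"
    from subspace_add[OF V_pred_subspace this]
    show "x + y - (?a + ?b) \<in> V_pred V n" by (simp add: algebra_simps)
  next
    assume "z - (?a + ?b) \<in> V_pred V n"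
    then show "\<exists>x y. z = x + y \<and> x - ?a \<in> V_pred V n \<and> y - ?b \<in> V_pred V n"
      by (intro exI[of _ "z - ?b"] exI[of _ ?b])
        (auto simp: algebra_simps subspace_0[OF V_pred_subspace])
  qed
  then show "(gr_lift F \<oplus>\<^bsub>assoc_graded V\<^esub> gr_lift G) n = gr_lift (F + G) n"
    by (auto simp: assoc_graded_def gr_lift_def in_gr_class)
qed

lemma gr_lift_mult:
  assumes F: "F \<in> gr_reps" and G: "G \<in> gr_reps"
  shows "gr_lift F \<otimes>\<^bsub>assoc_graded V\<^esub> gr_lift G = gr_lift (F * G)"
proof
  fix n
  let ?W = "V_pred V"
  have FV: "fps_nth F i \<in> V i" and GV: "fps_nth G i \<in> V i" for i
    using F G by (auto simp: gr_reps_def)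
  have *: "(\<Sum>i\<le>n. x i * y (n - i)) - fps_nth (F * G) n \<in> ?W n"
    if x: "\<And>i. x i - fps_nth F i \<in> ?W i" and y: "\<And>i. y i - fps_nth G i \<in> ?W i" for x y
  proof -
    have yV: "y i \<in> V i" for i
      using subspace_add[OF filtration_subspace GV[of i], of "y i - fps_nth G i"] y[of i]
        V_pred_subset[of i] by auto
    have "x i * y (n - i) - fps_nth F i * fps_nth G (n - i) \<in> ?W n" if "i \<le> n" for i
    proof -
      have "(x i - fps_nth F i) * y (n - i) + fps_nth F i * (y (n - i) - fps_nth G (n - i))
              \<in> ?W (i + (n - i))"
        by (intro subspace_add[OF V_pred_subspace] V_pred_mult_left V_pred_mult_right x y yV FV)
      with that show ?thesis by (simp add: algebra_simps)
    qed
    then have "(\<Sum>i\<le>n. x i * y (n - i) - fps_nth F i * fps_nth G (n - i)) \<in> ?W n"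
      by (intro subspace_sum[OF V_pred_subspace]) auto
    then show ?thesis by (simp add: fps_mult_nth sum_subtractf atLeast0AtMost)
  qed
  have "(\<exists>x y w. z = (\<Sum>i\<le>n. x i * y (n - i)) + w \<and> (\<forall>i. x i - fps_nth F i \<in> ?W i) \<and>
           (\<forall>j. y j - fps_nth G j \<in> ?W j) \<and> w \<in> ?W n) \<longleftrightarrow>
        z - fps_nth (F * G) n \<in> ?W n" for z
  proof safe
    fix x y w assume "\<forall>i. x i - fps_nth F i \<in> ?W i" "\<forall>j. y j - fps_nth G j \<in> ?W j" "w \<in> ?W n"
    then show "(\<Sum>i\<le>n. x i * y (n - i)) + w - fps_nth (F * G) n \<in> ?W n"
      using subspace_add[OF V_pred_subspace *[of x y], of w] by (simp add: algebra_simps)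
  next
    assume "z - fps_nth (F * G) n \<in> ?W n"
    then show "\<exists>x y w. z = (\<Sum>i\<le>n. x i * y (n - i)) + w \<and> (\<forall>i. x i - fps_nth F i \<in> ?W i) \<and>
           (\<forall>j. y j - fps_nth G j \<in> ?W j) \<and> w \<in> ?W n"
      by (intro exI[of _ "fps_nth F"] exI[of _ "fps_nth G"] exI[of _ "z - fps_nth (F * G) n"])
        (auto simp: fps_mult_nth atLeast0AtMost subspace_0[OF V_pred_subspace])
  qed
  then show "(gr_lift F \<otimes>\<^bsub>assoc_graded V\<^esub> gr_lift G) n = gr_lift (F * G) n"
    by (auto simp: assoc_graded_def gr_lift_def in_gr_class)
qed

lemma gr_reps_0: "0 \<in> gr_reps"
  by (simp add: gr_reps_def subspace_0[OF filtration_subspace])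

lemma gr_reps_add:
  assumes "F \<in> gr_reps" "G \<in> gr_reps"
  shows "F + G \<in> gr_reps"
proof -
  have "{n. fps_nth (F + G) n \<noteq> 0} \<subseteq> {n. fps_nth F n \<noteq> 0} \<union> {n. fps_nth G n \<noteq> 0}" by auto
  then have "finite {n. fps_nth (F + G) n \<noteq> 0}"
    by (rule finite_subset) (use assms in \<open>auto simp: gr_reps_def\<close>)
  with assms show ?thesis
    by (simp add: gr_reps_def subspace_add[OF filtration_subspace])
qed

lemma gr_reps_uminus: "F \<in> gr_reps \<Longrightarrow> - F \<in> gr_reps"
  by (auto simp: gr_reps_def subspace_neg[OF filtration_subspace])

lemma gr_reps_mult:
  assumes "F \<in> gr_reps" "G \<in> gr_reps"
  shows "F * G \<in> gr_reps"
proof -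
  let ?A = "{n. fps_nth F n \<noteq> 0}" and ?B = "{n. fps_nth G n \<noteq> 0}"
  have "n \<in> (\<lambda>(i, j). i + j) ` (?A \<times> ?B)" if n: "fps_nth (F * G) n \<noteq> 0" for n
  proof -
    from n have "(\<Sum>i=0..n. fps_nth F i * fps_nth G (n - i)) \<noteq> 0" 
      by (simp add: fps_mult_nth)
    then obtain i where "i \<in> {0..n}" "fps_nth F i * fps_nth G (n - i) \<noteq> 0"
      by (rule sum.not_neutral_contains_not_neutral)
    then have "i + (n - i) = n" "fps_nth F i \<noteq> 0" "fps_nth G (n - i) \<noteq> 0" by auto
    then show ?thesis by (intro image_eqI[of _ _ "(i, n - i)"]) auto
  qed
  then have "{n. fps_nth (F * G) n \<noteq> 0} \<subseteq> (\<lambda>(i, j). i + j) ` (?A \<times> ?B)" by blast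
  moreover have "finite ((\<lambda>(i, j). i + j) ` (?A \<times> ?B))"
    using assms by (auto simp: gr_reps_def)
  ultimately have "finite {n. fps_nth (F * G) n \<noteq> 0}" by (rule finite_subset)
  moreover have "fps_nth (F * G) n \<in> V n" for n
    unfolding fps_mult_nth
  proof (rule subspace_sum[OF filtration_subspace])
    fix i assume "i \<in> {0..n}"
    then show "fps_nth F i * fps_nth G (n - i) \<in> V n"
      using assms filtration_mult[of "fps_nth F i" i "fps_nth G (n - i)" "n - i"]
      by (auto simp: gr_reps_def)
  qed
  ultimately show ?thesis by (simp add: gr_reps_def)
qed

lemma ring_assoc_graded:
  assumes one: "1 \<in> V 0"
  shows "ring (assoc_graded V)"
proof -
  have one_rep: "1 \<in> gr_reps"
  proof -
    have "{n. fps_nth (1 :: 'a fps) n \<noteq> 0} \<subseteq> {0}" by auto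
    then have "finite {n. fps_nth (1 :: 'a fps) n \<noteq> 0}" by (rule finite_subset) simp
    with one show ?thesis by (auto simp: gr_reps_def subspace_0[OF filtration_subspace])
  qed
  note simps = carrier_assoc_graded gr_lift_zero gr_lift_one gr_lift_add gr_lift_mult
    gr_reps_0 gr_reps_add gr_reps_mult one_rep
  show ?thesis
  proof (rule ringI)
    show "abelian_group (assoc_graded V)"
    proof (rule abelian_groupI)
      fix x assume "x \<in> carrier (assoc_graded V)"
      then obtain F where "x = gr_lift F" "F \<in> gr_reps" by (auto simp: simps)
      then show "\<exists>y\<in>carrier (assoc_graded V). y \<oplus>\<^bsub>assoc_graded V\<^esub> x = \<zero>\<^bsub>assoc_graded V\<^esub>"
        by (intro bexI[of _ "gr_lift (- F)"]) (auto simp: simps gr_reps_uminus)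
    qed (auto simp: simps ac_simps)
    show "monoid (assoc_graded V)"
      by (rule monoidI) (auto simp: simps mult.assoc)
  qed (auto simp: simps distrib_left distrib_right)
qed

text \<open>Since the components of \<open>1\<close> in the graded ring are formed in degree \<open>0\<close>, that ring has a
  unit only if \<open>1 \<in> V 0\<close>. Absence of zero divisors forces this, so that requiring a unit
  in the notion of a domain adds nothing to the assumption that the graded ring is a domain.\<close>

lemma one_in_V_0:
  assumes nzd: "\<And>f g. f \<in> carrier (assoc_graded V) \<Longrightarrow> g \<in> carrier (assoc_graded V) \<Longrightarrow>
      f \<otimes>\<^bsub>assoc_graded V\<^esub> g = \<zero>\<^bsub>assoc_graded V\<^esub> \<Longrightarrow>
      f = \<zero>\<^bsub>assoc_graded V\<^esub> \<or> g = \<zero>\<^bsub>assoc_graded V\<^esub>"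
  shows "1 \<in> V 0"
proof (rule ccontr)
  assume not0: "1 \<notin> V 0"
  have "1 \<in> (\<Union>n. V n)" using filt by (simp add: filtration_def)
  then have ex: "\<exists>n. 1 \<in> V n" by blast
  define n where "n = (LEAST n. 1 \<in> V n)"
  have n: "1 \<in> V n" unfolding n_def by (rule LeastI_ex[OF ex])
  have "n \<noteq> 0" using n not0 by metis
  then have npred: "1 \<notin> V_pred V n"
    using not_less_Least[of "n - 1" "\<lambda>n. 1 \<in> V n"] by (simp add: V_pred_def n_def)
  define F :: "'a fps" where "F = fps_X ^ n"
  have F: "F \<in> gr_reps"
    using n by (auto simp: F_def gr_reps_def fps_X_power_nth subspace_0[OF filtration_subspace])
  have "gr_lift (F * F) = gr_lift 0"
  proof
    fix m
    have "n \<le> n + n - 1" using \<open>n \<noteq> 0\<close> by simp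
    then have "1 \<in> V_pred V (n + n)"
      using n filtration_mono[of n "n + n - 1"] \<open>n \<noteq> 0\<close> by (auto simp: V_pred_def)
    then show "gr_lift (F * F) m = gr_lift 0 m"
      by (simp add: gr_lift_def gr_class_eq_iff F_def fps_X_power_nth
            subspace_0[OF V_pred_subspace] flip: power_add)
  qed
  then have "gr_lift F = gr_lift 0"
    using nzd[of "gr_lift F" "gr_lift F"] F by (simp add: carrier_assoc_graded gr_lift_mult gr_lift_zero)
  then have "gr_lift F n = gr_lift 0 n" by simp
  with npred show False by (simp add: gr_lift_def gr_class_eq_iff F_def fps_X_power_nth)
qed

end

definition nc_domain :: "('b, 'm) ring_scheme \<Rightarrow> bool" where
  "nc_domain R \<longleftrightarrow> ring R \<and> \<one>\<^bsub>R\<^esub> \<noteq> \<zero>\<^bsub>R\<^esub> \<and>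
     (\<forall>x\<in>carrier R. \<forall>y\<in>carrier R. x \<otimes>\<^bsub>R\<^esub> y = \<zero>\<^bsub>R\<^esub> \<longrightarrow> x = \<zero>\<^bsub>R\<^esub> \<or> y = \<zero>\<^bsub>R\<^esub>)"

section \<open>Finite factorization domains\<close>

definition nc_unit :: "'a::ring_1 \<Rightarrow> bool" where
  "nc_unit u \<longleftrightarrow> (\<exists>v. u * v = 1 \<and> v * u = 1)"

definition central_unit :: "'a::ring_1 \<Rightarrow> bool" where
  "central_unit u \<longleftrightarrow> nc_unit u \<and> (\<forall>x. u * x = x * u)"

definition nc_irreducible :: "'a::ring_1 \<Rightarrow> bool" where
  "nc_irreducible a \<longleftrightarrow> a \<noteq> 0 \<and> \<not> nc_unit a \<and>
     \<not> (\<exists>b c. \<not> nc_unit b \<and> \<not> nc_unit c \<and> a = b * c)"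

definition factorizations :: "'a::ring_1 \<Rightarrow> 'a list set" where
  "factorizations a = {as. (\<forall>p\<in>set as. nc_irreducible p) \<and> prod_list as = a}"

definition factorization_equiv :: "'a::ring_1 \<Rightarrow> ('a list \<times> 'a list) set" where
  "factorization_equiv a =
     {(as, bs). as \<in> factorizations a \<and> bs \<in> factorizations a \<and>
                list_all2 (\<lambda>p q. \<exists>u. central_unit u \<and> q = u * p) as bs}"

lemma central_unit_1: "central_unit 1"
  by (auto simp: central_unit_def nc_unit_def)

lemma central_unit_mult:
  assumes "central_unit u" "central_unit v"
  shows "central_unit (u * v)"
proof -
  obtain u' v' where uv: "u * u' = 1" "u' * u = 1" "v * v' = 1" "v' * v = 1"
    using assms by (auto simp: central_unit_def nc_unit_def)
  have "(u * v) * (v' * u') = u * (v * v') * u'" by (simp only: mult.assoc)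
  moreover have "(v' * u') * (u * v) = v' * (u' * u) * v" by (simp only: mult.assoc)
  ultimately have "nc_unit (u * v)"
    using uv unfolding nc_unit_def by auto
  moreover have "(u * v) * x = x * (u * v)" for x
    using assms unfolding central_unit_def by (metis mult.assoc)
  ultimately show ?thesis by (auto simp: central_unit_def)
qed

lemma central_unit_inverse:
  assumes "central_unit u"
  obtains v where "central_unit v" "v * u = 1"
proof -
  obtain v where v: "u * v = 1" "v * u = 1"
    using assms by (auto simp: central_unit_def nc_unit_def)
  have "v * x = x * v" for x
  proof -
    have "v * x = v * (x * u) * v" using v by (simp add: mult.assoc)
    also have "x * u = u * x" using assms by (simp add: central_unit_def)
    also have "v * (u * x) * v = x * v" using v by (simp flip: mult.assoc)
    finally show ?thesis .
  qed
  with v have "central_unit v" by (auto simp: central_unit_def nc_unit_def)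
  with v show ?thesis by (intro that)
qed

lemma equiv_factorization_equiv: "equiv (factorizations a) (factorization_equiv a)"
proof (rule equivI)
  let ?R = "\<lambda>p q :: 'a. \<exists>u. central_unit u \<and> q = u * p"
  show "factorization_equiv a \<subseteq> factorizations a \<times> factorizations a"
    by (auto simp: factorization_equiv_def)
  have "?R p p" for p using central_unit_1 by (intro exI[of _ 1]) auto
  then show "refl_on (factorizations a) (factorization_equiv a)"
    by (auto simp: refl_on_def factorization_equiv_def intro!: list_all2_refl)
  have "?R q p" if "?R p q" for p q
    using that by (metis central_unit_inverse mult.assoc mult_1_left)
  then have "list_all2 ?R bs as" if "list_all2 ?R as bs" for as bs
    using that by (simp add: list_all2_conv_all_nth)
  then show "sym (factorization_equiv a)"
    unfolding sym_def factorization_equiv_def by blast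
  have "?R p r" if "?R p q" "?R q r" for p q r
    using that by (metis central_unit_mult mult.assoc)
  then have "list_all2 ?R as cs" if "list_all2 ?R as bs" "list_all2 ?R bs cs" for as bs cs
    using list_all2_trans[of ?R ?R ?R, OF _ that] by blast
  then show "trans (factorization_equiv a)"
    unfolding trans_def factorization_equiv_def by blast
qed

definition finite_factorization_domain :: "'a::ring_1 itself \<Rightarrow> bool" where
  "finite_factorization_domain _ \<longleftrightarrow>
     (\<forall>x y :: 'a. x * y = 0 \<longrightarrow> x = 0 \<or> y = 0) \<and>
     (\<forall>a :: 'a. a \<noteq> 0 \<and> \<not> nc_unit a \<longrightarrow>
        factorizations a \<noteq> {} \<and> finite (factorizations a // factorization_equiv a))"

end

theory Submission
  imports Defs
begin

text \<open>The degree function of the filtration is additive because the graded ring is a domain, so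
  each factorization of \<open>a\<close> is a chain of splittings \<open>b c = a\<close> with \<open>b\<close> and \<open>c\<close> in the
  finite-dimensional space \<open>V (deg a)\<close>, and it suffices that there are only finitely many such
  splittings up to scalars. Geometrically, multiplication induces a morphism from a product of
  two projective spaces to a projective space; since it pulls \<open>O(1)\<close> back to the ample \<open>O(1, 1)\<close>,
  its fibres are finite.

  The elementary argument used here is a degeneration. Were there infinitely many splittings,
  some product of coordinates \<open>b\<^sub>p c\<^sub>q\<close> would take infinitely many values \<open>1 / t\<close>. A maximal
  subalgebra of the functions on these \<open>t\<close> with a limit at \<open>t = 0\<close> extending evaluation of
  polynomials, obtained from Zorn's lemma, behaves like a valuation ring. Rescaling \<open>b\<close> and
  \<open>c\<close> so that both have nonzero limits forces the product of these limits to vanish, as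
  \<open>a = b c\<close> has been multiplied by a factor tending to \<open>0\<close>.\<close>

section \<open>Places\<close>

text \<open>A one-variable Nullstellensatz. A nonzero \<open>p\<close> of least degree in
  \<open>I\<close> has no root \<open>r\<close>: some \<open>q\<close> in \<open>I\<close> is
  nonzero at \<open>r\<close>, and \<open>q mod p\<close>, with the same value at \<open>r\<close>,
  would be a nonzero element of smaller degree.\<close>

lemma poly_ideal_without_common_root:
  fixes I :: "'k::alg_closed_field poly set"
  assumes add: "\<And>p q. p \<in> I \<Longrightarrow> q \<in> I \<Longrightarrow> p + q \<in> I"
    and mult: "\<And>p q. p \<in> I \<Longrightarrow> p * q \<in> I"
    and noroot: "\<And>r. \<exists>p\<in>I. poly p r \<noteq> 0"
  shows "1 \<in> I"
proof -
  have "\<exists>p. p \<in> I \<and> p \<noteq> 0" using noroot[of 0] by fastforce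
  then obtain p where p: "p \<in> I" "p \<noteq> 0"
    and least: "\<And>q. q \<in> I \<Longrightarrow> q \<noteq> 0 \<Longrightarrow> degree p \<le> degree q"
    using ex_has_least_nat[of "\<lambda>p. p \<in> I \<and> p \<noteq> 0" _ degree] by blast
  show ?thesis
  proof (cases "degree p = 0")
    case True
    then obtain c where c: "p = [:c:]" by (rule degree_eq_zeroE)
    then have "p * [:1 / c:] = 1" using p(2) by (simp add: one_pCons)
    then show ?thesis using mult[OF p(1)] by metis
  next
    case False
    then obtain r where r: "poly p r = 0" using alg_closed_imp_poly_has_root[of p] by auto
    obtain q where q: "q \<in> I" "poly q r \<noteq> 0" using noroot by blast
    have eq: "q mod p = q + p * (- (q div p))"
      using div_mult_mod_eq[of q p] by (simp add: algebra_simps)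
    have "q mod p \<in> I" unfolding eq by (intro add mult q p)
    moreover have "poly (q mod p) r = poly q r" by (simp add: eq r)
    then have "q mod p \<noteq> 0" using q(2) by auto
    ultimately have "degree p \<le> degree (q mod p)" by (rule least)
    then show ?thesis using degree_mod_less[OF p(2), of q] \<open>q mod p \<noteq> 0\<close> by simp
  qed
qed

text \<open>Only the values on \<open>T\<close> and at \<open>0\<close> matter: \<open>f 0\<close> plays the role of the limit of
  the restriction of \<open>f\<close> to \<open>T\<close>, and \<open>limit\<close> says that it depends on that restriction only.\<close>

locale place =
  fixes T :: "'k::field set" and G :: "('k \<Rightarrow> 'k) set"
  assumes zero_notin: "0 \<notin> T"
    and const: "(\<lambda>_. c) \<in> G"
    and ident: "(\<lambda>t. t) \<in> G"
    and add: "f \<in> G \<Longrightarrow> g \<in> G \<Longrightarrow> (\<lambda>t. f t + g t) \<in> G"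
    and mult: "f \<in> G \<Longrightarrow> g \<in> G \<Longrightarrow> (\<lambda>t. f t * g t) \<in> G"
    and limit: "f \<in> G \<Longrightarrow> (\<And>t. t \<in> T \<Longrightarrow> f t = 0) \<Longrightarrow> f 0 = 0"
begin

lemma diff: "f \<in> G \<Longrightarrow> g \<in> G \<Longrightarrow> (\<lambda>t. f t - g t) \<in> G"
  using add[of f "\<lambda>t. (-1) * g t"] mult[OF const[of "-1"], of g] by simp

lemma sum: "(\<And>i. i \<in> S \<Longrightarrow> f i \<in> G) \<Longrightarrow> (\<lambda>t. \<Sum>i\<in>S. f i t) \<in> G"
  by (induction S rule: infinite_finite_induct) (auto intro: add const)

lemma power: "f \<in> G \<Longrightarrow> (\<lambda>t. f t ^ n) \<in> G"
  by (induction n) (auto intro: mult const)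

lemma limit_eq:
  assumes "f \<in> G" "g \<in> G" "\<And>t. t \<in> T \<Longrightarrow> f t = g t"
  shows "f 0 = g 0"
  using limit[OF diff[OF assms(1,2)]] assms(3) by simp

text \<open>The polynomial ring over \<open>G\<close>, encoded as families indexed by
  \<open>t\<close>; the uniform degree bound makes a family a single polynomial over
  \<open>G\<close>, and \<open>F 0\<close> is its reduction at the place.\<close>

definition polys :: "('k \<Rightarrow> 'k poly) set" where
  "polys = {F. (\<forall>j. (\<lambda>t. coeff (F t) j) \<in> G) \<and> (\<exists>n. \<forall>t. degree (F t) \<le> n)}"

lemma polysI: "(\<And>j. (\<lambda>t. coeff (F t) j) \<in> G) \<Longrightarrow> (\<And>t. degree (F t) \<le> n) \<Longrightarrow> F \<in> polys"
  by (auto simp: polys_def)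

lemma polys_coeff: "F \<in> polys \<Longrightarrow> (\<lambda>t. coeff (F t) j) \<in> G"
  by (auto simp: polys_def)

lemma polys_monom:
  assumes "f \<in> G"
  shows "(\<lambda>t. monom (f t) n) \<in> polys"
proof (rule polysI)
  show "(\<lambda>t. coeff (monom (f t) n) j) \<in> G" for j
    by (cases "n = j") (simp_all add: assms const)
qed (rule degree_monom_le)

lemma polys_const: "(\<lambda>_. p) \<in> polys"
  by (rule polysI[of _ "degree p"]) (auto intro: const)

lemma polys_add:
  assumes "F \<in> polys" "H \<in> polys"
  shows "(\<lambda>t. F t + H t) \<in> polys"
proof -
  obtain n m where nm: "\<And>t. degree (F t) \<le> n" "\<And>t. degree (H t) \<le> m"
    using assms unfolding polys_def by blast
  have "degree (F t + H t) \<le> max n m" for t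
    using nm[of t] by (intro degree_add_le) (auto intro: max.coboundedI1 max.coboundedI2)
  then show ?thesis
    by (intro polysI[where n = "max n m"]) (simp_all add: add polys_coeff assms)
qed

lemma polys_mult:
  assumes "F \<in> polys" "H \<in> polys"
  shows "(\<lambda>t. F t * H t) \<in> polys"
proof -
  obtain n m where nm: "\<And>t. degree (F t) \<le> n" "\<And>t. degree (H t) \<le> m"
    using assms unfolding polys_def by blast
  have "degree (F t * H t) \<le> n + m" for t
    using nm[of t] degree_mult_le[of "F t" "H t"] by linarith
  moreover have "(\<lambda>t. coeff (F t * H t) j) \<in> G" for j
    unfolding coeff_mult by (intro sum mult polys_coeff assms)
  ultimately show ?thesis by (intro polysI[where n = "n + m"])
qed

lemma polys_diff: "F \<in> polys \<Longrightarrow> H \<in> polys \<Longrightarrow> (\<lambda>t. F t - H t) \<in> polys"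
  using polys_add[of F "\<lambda>t. (-1) * H t"] polys_mult[OF polys_const[of "-1"], of H] by simp

lemma polys_smult: "f \<in> G \<Longrightarrow> F \<in> polys \<Longrightarrow> (\<lambda>t. smult (f t) (F t)) \<in> polys"
  using polys_mult[OF polys_monom[of f 0]] by (simp add: monom_0)

text \<open>The two relations are played off against each other by Euclidean-style elimination
  of top and bottom coefficients.\<close>

lemma integral_relation_conflict:
  assumes "F \<in> polys" "\<And>t. degree (F t) \<le> n" "\<And>t. t \<in> T \<Longrightarrow> poly (F t) (x t) = 0"
    and "F 0 = [:c:]" "c \<noteq> 0"
    and "H \<in> polys" "\<And>t. degree (H t) \<le> N" "\<And>t. t \<in> T \<Longrightarrow> poly (H t) (x t) = 0"
    and "coeff (H 0) N \<noteq> 0"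
  shows False
  using assms
proof (induction "n + N" arbitrary: n N F H c rule: less_induct)
  case less
  note F = less.prems(1-5) and H = less.prems(6-9)
  show False
  proof (cases "N = 0")
    case True
    have "coeff (H t) 0 = 0" if "t \<in> T" for t
    proof -
      obtain a where "H t = [:a:]" using H(2)[of t] True by (auto elim: degree_eq_zeroE)
      then show ?thesis using H(3)[OF that] by simp
    qed
    then have "coeff (H 0) 0 = 0" using limit[OF polys_coeff[OF H(1), of 0]] by simp
    then show False using H(4) True by simp
  next
    case N: False
    show False
    proof (cases "N \<le> n")
      case True
      \<comment> \<open>The terms of degree \<open>n\<close> cancel, so the bound for
        \<open>F\<close> drops. As \<open>n > 0\<close>, the constant \<open>F 0\<close> has no such
        term, and \<open>F' 0\<close> is again a nonzero constant.\<close>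
      define F' where "F' t = smult (coeff (H t) N) (F t) - monom (coeff (F t) n) (n - N) * H t" for t
      have "F' \<in> polys"
        unfolding F'_def by (intro polys_diff polys_smult polys_mult polys_monom polys_coeff F H)
      moreover have "degree (F' t) \<le> n - 1" for t
      proof (rule degree_le, intro allI impI)
        fix j assume j: "n - 1 < j"
        show "coeff (F' t) j = 0"
        proof (cases "j = n")
          case True
          then show ?thesis using \<open>N \<le> n\<close> by (simp add: F'_def coeff_monom_mult)
        next
          case False
          then have "n < j" using j by simp
          then have "coeff (F t) j = 0" "coeff (H t) (j - (n - N)) = 0"
            using F(2)[of t] H(2)[of t] \<open>N \<le> n\<close> by (auto intro!: coeff_eq_0)
          then show ?thesis by (simp add: F'_def coeff_monom_mult)
        qed
      qed
      moreover have "poly (F' t) (x t) = 0" if "t \<in> T" for t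
        using F(3) H(3) that by (simp add: F'_def)
      moreover have "F' 0 = [:coeff (H 0) N * c:]"
        using F(4) N True by (cases n) (simp_all add: F'_def)
      ultimately show False
        using less.hyps[of "n - 1" N F' "coeff (H 0) N * c" H] F(5) H N True by simp
    next
      case False
      \<comment> \<open>\<open>D\<close> has no constant term, so \<open>x t\<close> divides its
        value. As \<open>x t\<close> may vanish it cannot be cancelled; the factor
        \<open>coeff (F t) 0\<close> in \<open>H'\<close> is a multiple of \<open>x t\<close> by the
        relation \<open>F\<close> and covers that case.\<close>
      define D where "D t = smult (coeff (F t) 0) (H t) - smult (coeff (H t) 0) (F t)" for t
      define H' where "H' t = smult (coeff (F t) 0) (poly_shift 1 (D t))" for t
      have D: "D \<in> polys"
        unfolding D_def by (intro polys_diff polys_smult polys_coeff F H)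
      have degD: "degree (D t) \<le> N" for t
        unfolding D_def
        by (intro degree_diff_le order.trans[OF degree_smult_le])
          (use F(2)[of t] H(2)[of t] False in auto)
      have degS: "degree (poly_shift 1 (D t)) \<le> N - 1" for t
        by (rule degree_le) (use degD[of t] N in \<open>auto simp: coeff_poly_shift intro!: coeff_eq_0\<close>)
      have "poly_shift 1 \<circ> D \<in> polys"
        by (rule polysI[of _ "N - 1"]) (use degS polys_coeff[OF D] in \<open>auto simp: coeff_poly_shift\<close>)
      then have "H' \<in> polys"
        unfolding H'_def o_def by (intro polys_smult polys_coeff F)
      moreover have "degree (H' t) \<le> N - 1" for t
        unfolding H'_def by (rule order.trans[OF degree_smult_le degS])
      moreover have "poly (H' t) (x t) = 0" if "t \<in> T" for t
      proof -
        have shift: "p = pCons (coeff p 0) (poly_shift 1 p)" for p :: "'k poly"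
          by (rule poly_eqI) (simp add: coeff_pCons coeff_poly_shift split: nat.split)
        have "poly p (x t) = coeff p 0 + x t * poly (poly_shift 1 p) (x t)" for p
          by (subst shift) simp
        from this[of "D t"] this[of "F t"]
        have "x t * poly (poly_shift 1 (D t)) (x t) = 0"
          "coeff (F t) 0 = - (x t * poly (poly_shift 1 (F t)) (x t))"
          using F(3) H(3) that by (simp_all add: D_def eq_neg_iff_add_eq_0)
        then show ?thesis by (auto simp: H'_def)
      qed
      moreover have "coeff (H' 0) (N - 1) \<noteq> 0"
        using F(4,5) H(4) N by (cases N) (simp_all add: H'_def D_def coeff_poly_shift)
      ultimately show False
        using less.hyps[of n "N - 1" F c H'] F N by simp
    qed
  qed
qed

end

section \<open>Maximal places and the valuation property\<close>

locale maximal_place = place T G for T :: "'k::alg_closed_field set" and G +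
  assumes maximal: "place T G' \<Longrightarrow> G \<subseteq> G' \<Longrightarrow> G' = G"
begin

text \<open>If the reductions \<open>F 0\<close> of all relations for \<open>x\<close> had a common
  root \<open>r\<close>, then \<open>x\<close> with value \<open>r\<close> at \<open>0\<close> could
  be adjoined to \<open>G\<close>, against maximality. So the ideal of these reductions contains
  \<open>1\<close>.\<close>

lemma relation_of_nonmember:
  assumes x: "\<not> (\<exists>g\<in>G. \<forall>t\<in>T. g t = x t)"
  obtains F where "F \<in> polys" "F 0 = 1" "\<And>t. t \<in> T \<Longrightarrow> poly (F t) (x t) = 0"
proof -
  define I where "I = {F 0 | F. F \<in> polys \<and> (\<forall>t\<in>T. poly (F t) (x t) = 0)}"
  have "1 \<in> I"
  proof (rule poly_ideal_without_common_root)
    show "p + q \<in> I" if pq: "p \<in> I" "q \<in> I" for p q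
    proof -
      obtain F H where "p = F 0" "F \<in> polys" "\<forall>t\<in>T. poly (F t) (x t) = 0"
        "q = H 0" "H \<in> polys" "\<forall>t\<in>T. poly (H t) (x t) = 0"
        using pq unfolding I_def by blast
      then show ?thesis unfolding I_def
        by (intro CollectI exI[of _ "\<lambda>t. F t + H t"]) (auto intro: polys_add)
    qed
    show "p * q \<in> I" if p: "p \<in> I" for p q
    proof -
      obtain F where "p = F 0" "F \<in> polys" "\<forall>t\<in>T. poly (F t) (x t) = 0"
        using p unfolding I_def by blast
      then show ?thesis unfolding I_def
        by (intro CollectI exI[of _ "\<lambda>t. F t * q"]) (auto intro: polys_mult polys_const)
    qed
    show "\<exists>p\<in>I. poly p r \<noteq> 0" for r
    proof (rule ccontr)
      assume none: "\<not> (\<exists>p\<in>I. poly p r \<noteq> 0)"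
      define y where "y = x(0 := r)"
      have y: "y t = x t" if "t \<in> T" for t using that zero_notin by (auto simp: y_def)
      define G' where "G' = {\<lambda>t. poly (F t) (y t) | F. F \<in> polys}"
      have G'I: "f \<in> G'" if "F \<in> polys" "\<And>t. f t = poly (F t) (y t)" for f F
        using that unfolding G'_def by blast
      have sub: "G \<subseteq> G'"
        by (auto intro!: G'I polys_monom[of _ 0] simp: poly_monom)
      have "place T G'"
      proof
        show "0 \<notin> T" by (rule zero_notin)
        show "(\<lambda>_. c) \<in> G'" for c using sub const by blast
        show "(\<lambda>t. t) \<in> G'" using sub ident by blast
        fix f assume f: "f \<in> G'"
        then obtain F where F: "F \<in> polys" "f = (\<lambda>t. poly (F t) (y t))" by (auto simp: G'_def)
        show "(\<lambda>t. f t + g t) \<in> G'" "(\<lambda>t. f t * g t) \<in> G'" if g: "g \<in> G'" for g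
        proof -
          obtain H where H: "H \<in> polys" "g = (\<lambda>t. poly (H t) (y t))"
            using g by (auto simp: G'_def)
          show "(\<lambda>t. f t + g t) \<in> G'" by (rule G'I[OF polys_add[OF F(1) H(1)]]) (simp add: F H)
          show "(\<lambda>t. f t * g t) \<in> G'" by (rule G'I[OF polys_mult[OF F(1) H(1)]]) (simp add: F H)
        qed
        assume "\<And>t. t \<in> T \<Longrightarrow> f t = 0"
        \<comment> \<open>A polynomial in \<open>y\<close> vanishing on \<open>T\<close> is a
          relation for \<open>x\<close>, so its reduction vanishes at \<open>r\<close>, the value of
          \<open>y\<close> at \<open>0\<close>.\<close>
        then have "F 0 \<in> I" unfolding I_def using F y by auto
        then show "f 0 = 0" using none F(2) by (auto simp: y_def)
      qed
      then have "G' = G" using sub by (rule maximal)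
      moreover have "y \<in> G'"
        by (rule G'I[OF polys_const[of "[:0, 1:]"]]) simp
      ultimately show False using x y by blast
    qed
  qed
  then show ?thesis using that unfolding I_def by auto
qed

text \<open>The valuation property in the form due to Manis: it involves no division, so that the
  ring of all functions on \<open>T\<close> need not be replaced by a quotient field.\<close>

lemma valuation_property:
  "(\<exists>g\<in>G. \<forall>t\<in>T. g t = x t) \<or>
   (\<exists>g\<in>G. \<exists>h\<in>G. g 0 = 0 \<and> h 0 \<noteq> 0 \<and> (\<forall>t\<in>T. h t = g t * x t))"
proof (cases "\<exists>g\<in>G. \<forall>t\<in>T. g t = x t")
  case False
  then obtain F where F: "F \<in> polys" "F 0 = 1" "\<And>t. t \<in> T \<Longrightarrow> poly (F t) (x t) = 0"
    by (rule relation_of_nonmember) blast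
  obtain n where "\<And>t. degree (F t) \<le> n" using F(1) by (auto simp: polys_def)
  with F have "\<exists>g\<in>G. \<exists>h\<in>G. g 0 = 0 \<and> h 0 \<noteq> 0 \<and> (\<forall>t\<in>T. h t = g t * x t)"
  proof (induction n arbitrary: F)
    case 0
    have "F t = 0" if "t \<in> T" for t
    proof -
      obtain a where "F t = [:a:]" using 0(4)[of t] by (auto elim: degree_eq_zeroE)
      then show ?thesis using 0(3)[OF that] by simp
    qed
    then have "coeff (F 0) 0 = 0"
      using limit[OF polys_coeff[OF 0(1), of 0]] by simp
    then show ?case using 0 by simp
  next
    case (Suc n)
    \<comment> \<open>The leading coefficient has limit \<open>0\<close> because
      \<open>F 0 = 1\<close>. Multiplying the relation by \<open>u t ^ n\<close> makes it monic in
      \<open>y = u * x\<close>; this is \<open>H\<close>.\<close>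
    define u where "u t = coeff (F t) (Suc n)" for t
    have u: "u \<in> G" "u 0 = 0"
      using polys_coeff[OF Suc.prems(1)] Suc.prems(2) by (auto simp: u_def[abs_def])
    define y where "y t = u t * x t" for t
    define H where "H t = monom 1 (Suc n) + (\<Sum>j\<le>n. monom (coeff (F t) j * u t ^ (n - j)) j)" for t
    have coeff_H: "coeff (H t) j =
        (if j = Suc n then 1 else if j \<le> n then coeff (F t) j * u t ^ (n - j) else 0)" for t j
      by (simp add: H_def coeff_sum)
    have degH: "degree (H t) \<le> Suc n" for t
      by (rule degree_le) (simp add: coeff_H)
    have H: "H \<in> polys"
    proof (rule polysI[OF _ degH])
      show "(\<lambda>t. coeff (H t) j) \<in> G" for j
      proof (cases "j \<le> n")
        case True
        then show ?thesis by (simp add: coeff_H) (intro mult power u polys_coeff Suc.prems)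
      next
        case False
        then show ?thesis by (cases "j = Suc n") (simp_all add: coeff_H const)
      qed
    qed
    have poly_H: "poly (H t) (y t) = 0" if "t \<in> T" for t
    proof -
      have "u t ^ n * poly (F t) (x t) = u t ^ n * (\<Sum>j\<le>Suc n. coeff (F t) j * x t ^ j)"
      proof -
        have "F t = (\<Sum>j\<le>Suc n. monom (coeff (F t) j) j)"
          using Suc.prems(4)[of t] by (metis poly_as_sum_of_monoms')
        then have "poly (F t) (x t) = poly (\<Sum>j\<le>Suc n. monom (coeff (F t) j) j) (x t)" by simp
        then show ?thesis by (simp only: poly_sum poly_monom)
      qed
      also have "\<dots> = y t ^ Suc n + (\<Sum>j\<le>n. coeff (F t) j * (u t ^ n * x t ^ j))"
        by (simp add: y_def u_def distrib_left sum_distrib_left algebra_simps power_mult_distrib)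
      also have "(\<Sum>j\<le>n. coeff (F t) j * (u t ^ n * x t ^ j)) =
          (\<Sum>j\<le>n. coeff (F t) j * u t ^ (n - j) * y t ^ j)"
      proof (rule sum.cong)
        fix j assume "j \<in> {..n}"
        then have "u t ^ n = u t ^ (n - j) * u t ^ j" by (simp flip: power_add)
        then show "coeff (F t) j * (u t ^ n * x t ^ j) = coeff (F t) j * u t ^ (n - j) * y t ^ j"
          by (simp add: y_def power_mult_distrib)
      qed simp
      also have "y t ^ Suc n + \<dots> = poly (H t) (y t)"
        by (simp add: H_def poly_sum poly_monom)
      finally show ?thesis using Suc.prems(3)[OF that] by simp
    qed
    \<comment> \<open>The integral element \<open>y\<close> lies in \<open>G\<close>: otherwise it
      would satisfy both a relation reducing to \<open>1\<close> and the monic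
      \<open>H\<close>.\<close>
    have "\<exists>g\<in>G. \<forall>t\<in>T. g t = y t"
    proof (rule ccontr)
      assume "\<not> ?thesis"
      then obtain E where E: "E \<in> polys" "E 0 = 1" "\<And>t. t \<in> T \<Longrightarrow> poly (E t) (y t) = 0"
        by (rule relation_of_nonmember) blast
      obtain m where "\<And>t. degree (E t) \<le> m" using E(1) by (auto simp: polys_def)
      then show False
        using integral_relation_conflict[OF E(1) _ E(3) _ _ H degH poly_H, of m 1] E(2)
        by (simp add: coeff_H one_pCons)
    qed
    then obtain g where g: "g \<in> G" "\<And>t. t \<in> T \<Longrightarrow> g t = y t" by blast
    show ?case
    proof (cases "g 0 = 0")
      case False
      then show ?thesis using u g by (intro bexI[of _ u] bexI[of _ g]) (auto simp: y_def)
    next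
      case True
      \<comment> \<open>The top term \<open>u * x ^ Suc n\<close> is traded for
        \<open>g * x ^ n\<close>, which lowers the degree; as \<open>u\<close> and \<open>g\<close>
        have limit \<open>0\<close>, the reduction stays \<open>1\<close>.\<close>
      define E where "E t = F t - monom (u t) (Suc n) + monom (g t) n" for t
      show ?thesis
      proof (rule Suc.IH)
        show "E \<in> polys"
          unfolding E_def by (intro polys_add polys_diff polys_monom u g Suc.prems)
        show "E 0 = 1" using Suc.prems(2) u True by (simp add: E_def)
        show "poly (E t) (x t) = 0" if "t \<in> T" for t
          using Suc.prems(3)[OF that] g(2)[OF that] by (simp add: E_def poly_monom y_def)
        show "degree (E t) \<le> n" for t
        proof (rule degree_le, intro allI impI)
          fix j assume "n < j"
          then show "coeff (E t) j = 0"
            using coeff_eq_0[of "F t" j] Suc.prems(4)[of t] by (auto simp: E_def u_def)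
        qed
      qed
    qed
  qed
  then show ?thesis ..
qed simp

end

text \<open>Zorn's lemma for all places on \<open>T\<close>. Polynomial functions form one, as a
  polynomial vanishing on the infinite set \<open>T\<close> is zero; in the union of a chain, any
  two functions lie in a common member.\<close>

lemma maximal_place_exists:
  fixes T :: "'k::alg_closed_field set"
  assumes "infinite T" "0 \<notin> T"
  obtains G where "maximal_place T G"
proof -
  have "\<exists>M\<in>{G. place T G}. \<forall>X\<in>{G. place T G}. M \<subseteq> X \<longrightarrow> X = M"
  proof (rule subset_Zorn_nonempty)
    have "place T (range poly)"
    proof
      show "(\<lambda>_. c) \<in> range poly" for c :: 'k
        by (intro image_eqI[of _ _ "[:c:]"]) auto
      show "(\<lambda>t. t) \<in> range (poly :: 'k poly \<Rightarrow> _)"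
        by (intro image_eqI[of _ _ "[:0, 1:]"]) auto
      fix f :: "'k \<Rightarrow> 'k" assume "f \<in> range poly"
      then obtain p where p: "f = poly p" by auto
      show "(\<lambda>t. f t + g t) \<in> range poly" "(\<lambda>t. f t * g t) \<in> range poly" if g: "g \<in> range poly" for g
      proof -
        obtain q where q: "g = poly q" using g by auto
        show "(\<lambda>t. f t + g t) \<in> range poly" unfolding p q
          by (intro image_eqI[of _ _ "p + q"]) auto
        show "(\<lambda>t. f t * g t) \<in> range poly" unfolding p q
          by (intro image_eqI[of _ _ "p * q"]) auto
      qed
      assume "\<And>t. t \<in> T \<Longrightarrow> f t = 0"
      then have "T \<subseteq> {t. poly p t = 0}" by (auto simp: p)
      then have "p = 0" using assms(1) poly_roots_finite[of p] finite_subset by blast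
      then show "f 0 = 0" by (simp add: p)
    qed (use assms in auto)
    then show "{G. place T G} \<noteq> {}" by blast
  next
    fix C assume "C \<noteq> {}" and C: "subset.chain {G. place T G} C"
    then obtain G0 where G0: "G0 \<in> C" by blast
    have pl: "place T G" if "G \<in> C" for G
      using C that by (auto simp: subset.chain_def)
    have common: "\<exists>G\<in>C. f \<in> G \<and> g \<in> G" if "f \<in> \<Union>C" "g \<in> \<Union>C" for f g
    proof -
      obtain G H where GH: "G \<in> C" "H \<in> C" "f \<in> G" "g \<in> H" using \<open>f \<in> \<Union>C\<close> \<open>g \<in> \<Union>C\<close> by blast
      then have "G \<subseteq> H \<or> H \<subseteq> G" using C by (auto simp: subset_chain_def)
      then show ?thesis using GH by blast
    qed
    have "place T (\<Union>C)"
    proof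
      show "(\<lambda>_. c) \<in> \<Union>C" for c using place.const[OF pl[OF G0]] G0 by blast
      show "(\<lambda>t. t) \<in> \<Union>C" using place.ident[OF pl[OF G0]] G0 by blast
      show "(\<lambda>t. f t + g t) \<in> \<Union>C" if "f \<in> \<Union>C" "g \<in> \<Union>C" for f g
        using common[OF that] place.add[OF pl] by blast
      show "(\<lambda>t. f t * g t) \<in> \<Union>C" if "f \<in> \<Union>C" "g \<in> \<Union>C" for f g
        using common[OF that] place.mult[OF pl] by blast
      show "f 0 = 0" if "f \<in> \<Union>C" "\<And>t. t \<in> T \<Longrightarrow> f t = 0" for f
        using that place.limit[OF pl] by blast
    qed (rule assms(2))
    then show "\<Union>C \<in> {G. place T G}" by simp
  qed
  then obtain G where "place T G" "\<And>G'. place T G' \<Longrightarrow> G \<subseteq> G' \<Longrightarrow> G' = G" by blast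
  then have "maximal_place T G"
    by (simp add: maximal_place_def maximal_place_axioms_def)
  then show ?thesis by (rule that)
qed

section \<open>Rescaling finite families to nonzero limits\<close>

context maximal_place
begin

text \<open>Functions on \<open>T\<close> do not form a field, and \<open>x\<close> may vanish on
  \<open>T\<close>, so possibly no multiple of \<open>x\<close> has a nonzero limit. The valuation
  property for \<open>d * x\<close> then leaves only limit \<open>0\<close>.\<close>

lemma normalised_function:
  obtains (infinitesimal) "\<And>d. \<exists>g\<in>G. g 0 = 0 \<and> (\<forall>t\<in>T. g t = d t * x t)"
  | (normalised) y h where "h \<in> G" "h 0 \<noteq> 0" "\<And>t. t \<in> T \<Longrightarrow> h t = y t * x t"
proof (cases "\<exists>y. \<exists>h\<in>G. h 0 \<noteq> 0 \<and> (\<forall>t\<in>T. h t = y t * x t)")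
  case True
  then show ?thesis using normalised by blast
next
  case False
  have "\<exists>g\<in>G. g 0 = 0 \<and> (\<forall>t\<in>T. g t = d t * x t)" for d
    using valuation_property[of "\<lambda>t. d t * x t"]
  proof (elim disjE bexE conjE)
    fix g assume "g \<in> G" "\<forall>t\<in>T. g t = d t * x t"
    then show ?thesis using False by blast
  next
    fix g h assume "h \<in> G" "h 0 \<noteq> 0" "\<forall>t\<in>T. h t = g t * (d t * x t)"
    then have "\<exists>h\<in>G. h 0 \<noteq> 0 \<and> (\<forall>t\<in>T. h t = (g t * d t) * x t)"
      by (intro bexI[of _ h]) (auto simp: mult.assoc)
    then show ?thesis using False by (elim notE exI[of _ "\<lambda>t. g t * d t"])
  qed
  then show ?thesis by (rule infinitesimal)
qed

text \<open>The common factor \<open>y\<close> chooses a representative of a projective point, and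
  the values \<open>g i 0\<close> are homogeneous coordinates of its limit.\<close>

lemma infinitesimal_or_normalised_family:
  assumes "finite I"
  shows "(\<forall>i\<in>I. \<forall>d. \<exists>g\<in>G. g 0 = 0 \<and> (\<forall>t\<in>T. g t = d t * x i t)) \<or>
    (\<exists>y g. (\<forall>i\<in>I. g i \<in> G \<and> (\<forall>t\<in>T. g i t = y t * x i t)) \<and> (\<exists>i\<in>I. g i 0 \<noteq> 0))"
  using assms
proof (induction I)
  case empty
  then show ?case by simp
next
  case (insert j I)
  show ?case
    using insert.IH
  proof (elim disjE exE conjE)
    assume inf: "\<forall>i\<in>I. \<forall>d. \<exists>g\<in>G. g 0 = 0 \<and> (\<forall>t\<in>T. g t = d t * x i t)"
    show ?thesis
    proof (cases rule: normalised_function[of "x j"])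
      case infinitesimal
      then show ?thesis using inf by (intro disjI1) blast
    next
      case (normalised y h)
      have "\<forall>i\<in>I. \<exists>g\<in>G. \<forall>t\<in>T. g t = y t * x i t" using inf by blast
      then obtain g where "\<And>i. i \<in> I \<Longrightarrow> g i \<in> G \<and> (\<forall>t\<in>T. g i t = y t * x i t)" by metis
      then show ?thesis using normalised insert.hyps
        by (intro disjI2 exI[of _ y] exI[of _ "g(j := h)"]) auto
    qed
  next
    fix y g assume g: "\<forall>i\<in>I. g i \<in> G \<and> (\<forall>t\<in>T. g i t = y t * x i t)" "\<exists>i\<in>I. g i 0 \<noteq> 0"
    show ?thesis
      using valuation_property[of "\<lambda>t. y t * x j t"]
    proof (elim disjE bexE conjE)
      fix h assume "h \<in> G" "\<forall>t\<in>T. h t = y t * x j t"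
      then show ?thesis using g insert.hyps
        by (intro disjI2 exI[of _ y] exI[of _ "g(j := h)"]) auto
    next
      \<comment> \<open>Rescaling by \<open>f\<close> keeps the earlier members in \<open>G\<close>,
        and the new member supplies the nonzero limit.\<close>
      fix f h assume "f \<in> G" "h \<in> G" "h 0 \<noteq> 0" "\<forall>t\<in>T. h t = f t * (y t * x j t)"
      then show ?thesis using g insert.hyps
        by (intro disjI2 exI[of _ "\<lambda>t. f t * y t"] exI[of _ "(\<lambda>i t. f t * g i t)(j := h)"])
          (auto intro: mult simp: mult.assoc)
    qed
  qed
qed

text \<open>The relation excludes the infinitesimal alternative, in which all terms
  \<open>d i * x i\<close> have limit \<open>0\<close> while their sum is the nonzero constant
  \<open>\<alpha>\<close>.\<close>

lemma normalised_family:
  assumes "finite I" "\<alpha> \<noteq> 0" "\<And>t. t \<in> T \<Longrightarrow> (\<Sum>i\<in>I. d i t * x i t) = \<alpha>"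
  obtains y g where "\<And>i. i \<in> I \<Longrightarrow> g i \<in> G" "\<And>i t. i \<in> I \<Longrightarrow> t \<in> T \<Longrightarrow> g i t = y t * x i t"
    "\<exists>i\<in>I. g i 0 \<noteq> 0"
  using infinitesimal_or_normalised_family[OF assms(1), of x]
proof
  assume "\<forall>i\<in>I. \<forall>d. \<exists>g\<in>G. g 0 = 0 \<and> (\<forall>t\<in>T. g t = d t * x i t)"
  then have "\<forall>i\<in>I. \<exists>g. g \<in> G \<and> g 0 = 0 \<and> (\<forall>t\<in>T. g t = d i t * x i t)" by blast
  then obtain g where g: "\<And>i. i \<in> I \<Longrightarrow> g i \<in> G" "\<And>i. i \<in> I \<Longrightarrow> g i 0 = 0"
    "\<And>i t. i \<in> I \<Longrightarrow> t \<in> T \<Longrightarrow> g i t = d i t * x i t"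
    by metis
  have "(\<Sum>i\<in>I. g i 0) = \<alpha>"
  proof (rule limit_eq[OF _ const])
    show "(\<lambda>t. \<Sum>i\<in>I. g i t) \<in> G" by (intro sum g)
    show "(\<Sum>i\<in>I. g i t) = \<alpha>" if "t \<in> T" for t
      using assms(3)[OF that] g(3)[OF _ that] by simp
  qed
  then show ?thesis using g(2) assms(2) by simp
qed (use that in blast)

end

section \<open>Finiteness of splittings\<close>

locale alg_closed_domain = k_algebra scale
  for scale :: "'k::alg_closed_field \<Rightarrow> 'a::ring_1 \<Rightarrow> 'a" +
  assumes zero_product: "(x :: 'a) * y = 0 \<Longrightarrow> x = 0 \<or> y = 0"
begin

lemma representation_eq_zeroD:
  assumes "independent E" "v \<in> span E" "\<And>e. representation E v e = 0"
  shows "v = 0"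
  using sum_nonzero_representation_eq[OF assms(1,2)] assms(3) by simp

lemma mult_sum_scale:
  "(\<Sum>i\<in>I. scale (f i) i) * (\<Sum>j\<in>J. scale (g j) j) =
    (\<Sum>i\<in>I. \<Sum>j\<in>J. scale (f i * g j) (i * j))"
  by (simp add: sum_product scale_mult_left scale_mult_right mult.commute)

text \<open>These products do not change when a scalar is moved from \<open>b\<close> to
  \<open>c\<close>, so their finiteness expresses finiteness of splittings up to scalars.\<close>

lemma finite_coordinate_products:
  assumes B: "finite B" "independent B" and a: "a \<noteq> 0" and pq: "p \<in> B" "q \<in> B"
  shows "finite {representation B b p * representation B c q | b c.
    b \<in> span B \<and> c \<in> span B \<and> b * c = a}" (is "finite ?S")
proof (rule ccontr)
  assume inf: "infinite ?S"
  \<comment> \<open>With the inverses as parameters \<open>t\<close>, the chosen product of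
    coordinates is \<open>1 / t\<close>, which has a pole at \<open>0\<close>.\<close>
  define T where "T = inverse ` (?S - {0})"
  have "infinite T"
    unfolding T_def
  proof
    assume "finite (inverse ` (?S - {0}))"
    then have "finite (?S - {0})" by (rule finite_imageD) (simp add: inj_on_def)
    then show False using inf by (simp only: finite_Diff2 finite.intros)
  qed
  moreover have "0 \<notin> T" by (auto simp: T_def)
  ultimately obtain G where "maximal_place T G" by (rule maximal_place_exists)
  then interpret maximal_place T G .
  have "\<forall>t\<in>T. \<exists>b c. b \<in> span B \<and> c \<in> span B \<and> b * c = a \<and>
      representation B b p * representation B c q = inverse t"
    unfolding T_def by force
  then obtain b c where bc: "\<And>t. t \<in> T \<Longrightarrow> b t \<in> span B" "\<And>t. t \<in> T \<Longrightarrow> c t \<in> span B"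
      "\<And>t. t \<in> T \<Longrightarrow> b t * c t = a"
      "\<And>t. t \<in> T \<Longrightarrow> representation B (b t) p * representation B (c t) q = inverse t"
    by metis
  define \<beta> where "\<beta> i t = representation B (b t) i" for i t
  define \<gamma> where "\<gamma> i t = representation B (c t) i" for i t
  \<comment> \<open>A basis of the whole algebra, since products of elements of \<open>B\<close> may
    leave \<open>span B\<close>.\<close>
  define E where "E = extend_basis {}"
  have E: "independent E" "span E = UNIV"
    unfolding E_def using independent_extend_basis span_extend_basis independent_empty by auto
  define \<rho> where "\<rho> v e = representation E v e" for v e
  have \<rho>: "\<rho> ((\<Sum>i\<in>B. scale (f i) i) * (\<Sum>j\<in>B. scale (g j) j)) e =
      (\<Sum>i\<in>B. \<Sum>j\<in>B. f i * g j * \<rho> (i * j) e)" for f g e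
    unfolding mult_sum_scale \<rho>_def
    by (simp add: representation_sum[OF E(1)] representation_scale[OF E(1)] E(2))
  have rel: "(\<Sum>i\<in>B. \<Sum>j\<in>B. \<beta> i t * \<gamma> j t * \<rho> (i * j) e) = \<rho> a e" if "t \<in> T" for t e
  proof -
    have "(\<Sum>i\<in>B. scale (\<beta> i t) i) = b t" "(\<Sum>j\<in>B. scale (\<gamma> j t) j) = c t"
      unfolding \<beta>_def \<gamma>_def using sum_representation_eq[OF B(2) _ B(1) subset_refl] bc that by auto
    then show ?thesis using \<rho>[of "\<lambda>i. \<beta> i t" "\<lambda>j. \<gamma> j t" e] bc(3)[OF that] by simp
  qed
  \<comment> \<open>A nonzero coordinate of \<open>a\<close> turns \<open>b * c = a\<close> into a
    linear relation for the \<open>\<beta> i\<close>, and likewise for the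
    \<open>\<gamma> j\<close>, with nonzero constant value, as \<open>normalised_family\<close>
    requires.\<close>
  obtain e where e: "\<rho> a e \<noteq> 0"
    using representation_eq_zeroD[OF E(1), of a] E(2) a by (auto simp: \<rho>_def)
  have rel1: "(\<Sum>i\<in>B. (\<Sum>j\<in>B. \<gamma> j t * \<rho> (i * j) e) * \<beta> i t) = \<rho> a e" if "t \<in> T" for t
    using rel[OF that, of e] by (simp add: sum_distrib_left sum_distrib_right ac_simps)
  obtain y g where g: "\<And>i. i \<in> B \<Longrightarrow> g i \<in> G" "\<And>i t. i \<in> B \<Longrightarrow> t \<in> T \<Longrightarrow> g i t = y t * \<beta> i t"
      "\<exists>i\<in>B. g i 0 \<noteq> 0"
    by (rule normalised_family[where x = \<beta>, OF B(1) e rel1]) (assumption, rule that)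
  have rel2: "(\<Sum>j\<in>B. (\<Sum>i\<in>B. \<beta> i t * \<rho> (i * j) e) * \<gamma> j t) = \<rho> a e" if "t \<in> T" for t
    by (subst rel[OF that, of e, symmetric], subst sum.swap)
      (simp add: sum_distrib_left sum_distrib_right ac_simps)
  obtain z h where h: "\<And>i. i \<in> B \<Longrightarrow> h i \<in> G" "\<And>i t. i \<in> B \<Longrightarrow> t \<in> T \<Longrightarrow> h i t = z t * \<gamma> i t"
      "\<exists>i\<in>B. h i 0 \<noteq> 0"
    by (rule normalised_family[where x = \<gamma>, OF B(1) e rel2]) (assumption, rule that)
  \<comment> \<open>Coordinates of the product of the rescaled factors; on \<open>T\<close> this
    product is \<open>y * z\<close> times \<open>a\<close>.\<close>
  define s where "s e' t = (\<Sum>i\<in>B. \<Sum>j\<in>B. g i t * h j t * \<rho> (i * j) e')" for e' t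
  have s_in: "s e' \<in> G" for e'
    unfolding s_def[abs_def] by (intro sum mult const g h)
  have s_eq: "s e' t = y t * z t * \<rho> a e'" if "t \<in> T" for e' t
    unfolding rel[OF that, of e', symmetric]
    by (simp add: s_def g(2)[OF _ that] h(2)[OF _ that] sum_distrib_left ac_simps)
  \<comment> \<open>On \<open>T\<close>, \<open>t * \<beta> p * \<gamma> q = 1\<close>, so
    \<open>y * z = t * g p * h q\<close>; the factor \<open>t\<close> has limit
    \<open>0\<close>.\<close>
  have s0: "s e 0 = (\<lambda>t. t * (g p t * h q t) * \<rho> a e) 0"
  proof (rule limit_eq[OF s_in])
    show "(\<lambda>t. t * (g p t * h q t) * \<rho> a e) \<in> G" by (intro mult const ident g h pq)
    show "s e t = t * (g p t * h q t) * \<rho> a e" if "t \<in> T" for t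
    proof -
      have "t \<noteq> 0" using that zero_notin by auto
      then have "t * (\<beta> p t * \<gamma> q t) = 1" using bc(4)[OF that] by (simp add: \<beta>_def \<gamma>_def)
      then have "y t * z t = y t * z t * (t * (\<beta> p t * \<gamma> q t))" by simp
      then show ?thesis
        by (auto simp add: s_eq[OF that] g(2)[OF pq(1) that] h(2)[OF pq(2) that] ac_simps)
    qed
  qed
  have "s e' 0 = 0" for e'
  proof -
    \<comment> \<open>Proportionality to the coordinates of \<open>a\<close> survives in the limit
      and carries the vanishing from \<open>e\<close> to every \<open>e'\<close>.\<close>
    have "\<rho> a e * s e' 0 = \<rho> a e' * s e 0"
      by (rule limit_eq[OF mult[OF const s_in] mult[OF const s_in]]) (simp add: s_eq)
    then show ?thesis using s0 e by simp
  qed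
  then have "\<rho> ((\<Sum>i\<in>B. scale (g i 0) i) * (\<Sum>j\<in>B. scale (h j 0) j)) e' = 0" for e'
    by (simp add: \<rho> s_def)
  then have "(\<Sum>i\<in>B. scale (g i 0) i) * (\<Sum>j\<in>B. scale (h j 0) j) = 0"
    using representation_eq_zeroD[OF E(1)] E(2) by (simp add: \<rho>_def)
  then have "(\<Sum>i\<in>B. scale (g i 0) i) = 0 \<or> (\<Sum>j\<in>B. scale (h j 0) j) = 0"
    by (rule zero_product)
  then show False
  proof
    assume "(\<Sum>i\<in>B. scale (g i 0) i) = 0"
    then show False using independentD[OF B(2,1) subset_refl, of "\<lambda>i. g i 0"] g(3) by blast
  next
    assume "(\<Sum>j\<in>B. scale (h j 0) j) = 0"
    then show False using independentD[OF B(2,1) subset_refl, of "\<lambda>j. h j 0"] h(3) by blast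
  qed
qed

text \<open>The matrix of coordinate products takes finitely many values and determines the pair up
  to moving a scalar between the factors; \<open>P\<close> holds one pair per matrix.\<close>

lemma finite_factor_pairs:
  assumes "finite B" "a \<noteq> 0"
  obtains P where "finite P" "\<And>b c. (b, c) \<in> P \<Longrightarrow> b * c = a"
    "\<And>b c. b \<in> span B \<Longrightarrow> c \<in> span B \<Longrightarrow> b * c = a \<Longrightarrow>
      \<exists>(b', c')\<in>P. \<exists>r. r \<noteq> 0 \<and> b = scale r b' \<and> c' = scale r c"
proof -
  obtain B' where B': "B' \<subseteq> B" "independent B'" "B \<subseteq> span B'"
    by (rule maximal_independent_subset)
  have fin: "finite B'" using B'(1) assms(1) by (rule finite_subset)
  have span: "span B' = span B"
    using B'(1,3) span_mono[of B' B] span_minimal[of B "span B'"] by auto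
  define Z where "Z = {(b, c). b \<in> span B' \<and> c \<in> span B' \<and> b * c = a}"
  define \<Phi> where "\<Phi> = (\<lambda>(b, c). \<lambda>(p, q)\<in>B' \<times> B'. representation B' b p * representation B' c q)"
  define S where "S = (\<lambda>(p, q). {representation B' b p * representation B' c q | b c.
    b \<in> span B' \<and> c \<in> span B' \<and> b * c = a})"
  have "\<Phi> ` Z \<subseteq> PiE (B' \<times> B') S"
    by (auto simp: \<Phi>_def Z_def S_def split: prod.splits if_splits) blast
  moreover have "finite (PiE (B' \<times> B') S)"
    using finite_coordinate_products[OF fin B'(2) assms(2)] fin
    by (intro finite_PiE) (auto simp: S_def)
  ultimately have finZ: "finite (\<Phi> ` Z)" by (rule finite_subset)
  show ?thesis
  proof (rule that)
    show "finite (inv_into Z \<Phi> ` \<Phi> ` Z)" by (rule finite_imageI[OF finZ])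
    show "b * c = a" if "(b, c) \<in> inv_into Z \<Phi> ` \<Phi> ` Z" for b c
      using that inv_into_into[of _ \<Phi> Z] by (fastforce simp: Z_def)
    fix b c assume bc: "b \<in> span B" "c \<in> span B" "b * c = a"
    then have Z: "(b, c) \<in> Z" by (simp add: Z_def span)
    obtain b' c' where b'c': "inv_into Z \<Phi> (\<Phi> (b, c)) = (b', c')" by fastforce
    have Z': "(b', c') \<in> Z" "\<Phi> (b', c') = \<Phi> (b, c)"
      using inv_into_into[of "\<Phi> (b, c)" \<Phi> Z] f_inv_into_f[of "\<Phi> (b, c)" \<Phi> Z] Z b'c' by auto
    have eq: "representation B' b' p * representation B' c' q =
        representation B' b p * representation B' c q" if "p \<in> B'" "q \<in> B'" for p q
      using fun_cong[OF Z'(2), of "(p, q)"] that by (simp add: \<Phi>_def)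
    have "b \<noteq> 0" "c \<noteq> 0" using bc(3) assms(2) by auto
    then obtain q where "representation B' c q \<noteq> 0"
      using representation_eq_zeroD[OF B'(2), of c] bc(2) span by blast
    moreover from this have "q \<in> B'" using representation_ne_zero by blast
    \<comment> \<open>Column \<open>q\<close>, where \<open>c\<close> has a nonzero coordinate,
      gives \<open>r\<close> as the ratio of the coordinates of \<open>c'\<close> and
      \<open>c\<close> there.\<close>
    ultimately obtain r where r: "\<And>p. p \<in> B' \<Longrightarrow> representation B' b p = r * representation B' b' p"
      using eq[of _ q] that[of "representation B' c' q / representation B' c q"]
      by (auto simp: field_simps)
    have "b = (\<Sum>p\<in>B'. scale (representation B' b p) p)"
      using sum_representation_eq[OF B'(2) _ fin subset_refl, of b] bc(1) span by simp
    also have "\<dots> = scale r (\<Sum>p\<in>B'. scale (representation B' b' p) p)"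
      by (simp add: r scale_sum_right)
    also have "(\<Sum>p\<in>B'. scale (representation B' b' p) p) = b'"
      using sum_representation_eq[OF B'(2) _ fin subset_refl, of b'] Z'(1) by (simp add: Z_def)
    finally have b: "b = scale r b'" .
    then have "r \<noteq> 0" using \<open>b \<noteq> 0\<close> by auto
    have "b' * (scale r c - c') = 0"
      using bc(3) Z'(1) by (simp add: b Z_def right_diff_distrib scale_mult_left scale_mult_right)
    then have "c' = scale r c"
      using zero_product[of b'] b \<open>b \<noteq> 0\<close> by fastforce
    then show "\<exists>(b', c')\<in>inv_into Z \<Phi> ` \<Phi> ` Z. \<exists>r. r \<noteq> 0 \<and> b = scale r b' \<and> c' = scale r c"
      using b \<open>r \<noteq> 0\<close> Z b'c' by (intro bexI[of _ "(b', c')"]) force+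
  qed
qed

text \<open>Left multiplication by \<open>u\<close> is injective on \<open>span B\<close>, hence surjective.\<close>

lemma nc_unit_of_finite_dimensional:
  assumes "finite B" "u \<noteq> 0" "1 \<in> span B" "\<And>x. x \<in> span B \<Longrightarrow> u * x \<in> span B"
  shows "nc_unit u"
proof -
  obtain B' where B': "B' \<subseteq> B" "independent B'" "B \<subseteq> span B'"
    by (rule maximal_independent_subset)
  have fin: "finite B'" using B'(1) assms(1) by (rule finite_subset)
  have span: "span B' = span B"
    using B'(1,3) span_mono[of B' B] span_minimal[of B "span B'"] by auto
  have inj: "inj ((*) u)"
  proof (rule injI)
    fix x y assume "u * x = u * y"
    then have "u * (x - y) = 0" by (simp add: right_diff_distrib)
    then show "x = y" using zero_product[of u "x - y"] assms(2) by simp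
  qed
  interpret m: module_hom scale scale "(*) u"
    by unfold_locales (simp_all add: distrib_left scale_mult_right)
  have ind: "independent ((*) u ` B')"
    by (rule m.independent_injective_image[OF B'(2) inj_on_subset[OF inj subset_UNIV]])
  have "1 \<in> span ((*) u ` B')"
  proof (rule ccontr)
    assume not: "1 \<notin> span ((*) u ` B')"
    have "insert 1 ((*) u ` B') \<subseteq> span B'"
      using assms(3,4) span span_base[of _ B'] by auto
    then have "card (insert 1 ((*) u ` B')) \<le> card B'"
      using independent_span_bound[OF fin independent_insertI[OF not ind]] by blast
    moreover have "1 \<notin> (*) u ` B'" using not span_base by blast
    ultimately show False
      using fin card_image[OF inj_on_subset[OF inj subset_UNIV], of B'] by simp
  qed
  then obtain v where v: "u * v = 1" unfolding m.span_image by auto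
  have "u * (v * u - 1) = 0" using v by (simp add: right_diff_distrib flip: mult.assoc)
  then have "v * u = 1" using zero_product assms(2) by fastforce
  then show ?thesis using v by (auto simp: nc_unit_def)
qed

end

section \<open>Filtered algebras\<close>

locale filtered_domain = k_algebra scale
  for scale :: "'k::alg_closed_field \<Rightarrow> 'a::ring_1 \<Rightarrow> 'a" +
  fixes V :: "nat \<Rightarrow> 'a set"
  assumes finite_dim: "finite_dim_filtration scale V"
    and gr_domain: "nc_domain (assoc_graded V)"
begin

lemma filt: "filtration scale V"
  using finite_dim by (simp add: finite_dim_filtration_def)

lemmas V_subspace = filtration_subspace[OF k_algebra_axioms filt]
  and V_mono = filtration_mono[OF k_algebra_axioms filt]
  and V_mult = filtration_mult[OF k_algebra_axioms filt]
  and pred_subspace = V_pred_subspace[OF k_algebra_axioms filt]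
  and gr_lift_eq = gr_lift_def[OF k_algebra_axioms filt]
  and gr_class_eq = gr_class_eq_iff[OF k_algebra_axioms filt]

lemma V_exhausts: "\<exists>n. x \<in> V n"
  using filt by (auto simp: filtration_def)

lemma gr_zero_product:
  assumes "f \<in> carrier (assoc_graded V)" "g \<in> carrier (assoc_graded V)"
    "f \<otimes>\<^bsub>assoc_graded V\<^esub> g = \<zero>\<^bsub>assoc_graded V\<^esub>"
  shows "f = \<zero>\<^bsub>assoc_graded V\<^esub> \<or> g = \<zero>\<^bsub>assoc_graded V\<^esub>"
  using gr_domain assms by (auto simp: nc_domain_def)

lemma one_in_V0: "1 \<in> V 0"
  using one_in_V_0[OF k_algebra_axioms filt gr_zero_product] by blast

text \<open>The classes of \<open>x\<close> and \<open>y\<close> in degrees \<open>n\<close> and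
  \<open>m\<close> are nonzero homogeneous elements of the graded domain, and their product is the
  class of \<open>x * y\<close> in degree \<open>n + m\<close>.\<close>

lemma leading_terms_mult:
  assumes x: "x \<in> V n" "x \<notin> V_pred V n" and y: "y \<in> V m" "y \<notin> V_pred V m"
  shows "x * y \<notin> V_pred V (n + m)"
proof
  assume xy: "x * y \<in> V_pred V (n + m)"
  define hom where "hom z n = Abs_fps (\<lambda>i. if i = n then z else 0)" for z :: 'a and n :: nat
  have nth: "fps_nth (hom z n) i = (if i = n then z else 0)" for z n i
    by (simp add: hom_def)
  have reps: "hom z n \<in> gr_reps V" if "z \<in> V n" for z n
    using that
    by (auto simp: gr_reps_def[OF k_algebra_axioms filt] nth subspace_0[OF V_subspace])
  have nz: "gr_lift V (hom z n) \<noteq> gr_lift V 0" if "z \<notin> V_pred V n" for z n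
  proof
    assume "gr_lift V (hom z n) = gr_lift V 0"
    then have "gr_lift V (hom z n) n = gr_lift V 0 n" by simp
    then show False
      using that by (simp add: gr_lift_eq gr_class_eq nth)
  qed
  have "gr_lift V (hom x n * hom y m) = gr_lift V 0"
  proof
    fix k
    have "fps_nth (hom x n * hom y m) k = (\<Sum>i=0..k. if i = n then x * fps_nth (hom y m) (k - i) else 0)"
      unfolding fps_mult_nth by (rule sum.cong) (auto simp: nth)
    also have "\<dots> = (if k = n + m then x * y else 0)"
      by (auto simp: nth)
    finally show "gr_lift V (hom x n * hom y m) k = gr_lift V 0 k"
      using xy by (simp add: gr_lift_eq gr_class_eq
          subspace_0[OF pred_subspace])
  qed
  then show False
    using gr_zero_product[of "gr_lift V (hom x n)" "gr_lift V (hom y m)"] nz x y reps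
    by (simp add: carrier_assoc_graded[OF k_algebra_axioms filt]
        gr_lift_zero[OF k_algebra_axioms filt] gr_lift_mult[OF k_algebra_axioms filt])
qed

section \<open>The degree function and existence of factorizations\<close>

definition deg :: "'a \<Rightarrow> nat" where
  "deg x = (LEAST n. x \<in> V n)"

lemma in_V_deg: "x \<in> V (deg x)"
  unfolding deg_def using V_exhausts by (rule LeastI_ex)

lemma deg_le: "x \<in> V n \<Longrightarrow> deg x \<le> n"
  unfolding deg_def by (rule Least_le)

lemma in_V: "deg x \<le> n \<Longrightarrow> x \<in> V n"
  using in_V_deg V_mono by blast

lemma notin_V_pred: "x \<noteq> 0 \<Longrightarrow> x \<notin> V_pred V (deg x)"
  using deg_le[of x "deg x - 1"] by (auto simp: V_pred_def)

lemma deg_eqI: "x \<in> V n \<Longrightarrow> x \<notin> V_pred V n \<Longrightarrow> deg x = n"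
  using deg_le[of x n] in_V[of x "n - 1"]
  by (cases "deg x = n") (auto simp: V_pred_def split: if_splits)

lemma deg_mult:
  assumes "x \<noteq> 0" "y \<noteq> 0"
  shows "x * y \<noteq> 0" "deg (x * y) = deg x + deg y"
proof -
  have "x * y \<notin> V_pred V (deg x + deg y)"
    by (intro leading_terms_mult in_V_deg notin_V_pred assms)
  then show "x * y \<noteq> 0" "deg (x * y) = deg x + deg y"
    using subspace_0[OF pred_subspace] V_mult[OF in_V_deg in_V_deg]
    by (auto intro: deg_eqI)
qed

sublocale alg_closed_domain scale
  by unfold_locales (use deg_mult(1) in blast)

lemma deg_scale: "r \<noteq> 0 \<Longrightarrow> deg (scale r x) = deg x"
proof -
  assume r: "r \<noteq> 0"
  have "scale r x \<in> V n \<longleftrightarrow> x \<in> V n" for n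
    using subspace_scale[OF V_subspace, of x n r]
      subspace_scale[OF V_subspace, of "scale r x" n "1 / r"] r by auto
  then show ?thesis by (simp add: deg_def)
qed

lemma V_span: obtains B where "finite B" "V n = span B"
  using finite_dim by (auto simp: finite_dim_filtration_def)

text \<open>An element of degree \<open>0\<close> multiplies the finite-dimensional space
  \<open>V 0\<close> into itself, and \<open>1\<close> lies in \<open>V 0\<close>, so it is a unit
  once it is nonzero.\<close>

lemma deg_pos: "x \<noteq> 0 \<Longrightarrow> \<not> nc_unit x \<Longrightarrow> deg x > 0"
proof (rule ccontr)
  assume x: "x \<noteq> 0" "\<not> nc_unit x" "\<not> deg x > 0"
  obtain B where B: "finite B" "V 0 = span B" by (rule V_span)
  have "x * y \<in> V 0" if "y \<in> V 0" for y
    using V_mult[of x 0 y 0] in_V_deg[of x] x(3) that by simp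
  then show False
    using nc_unit_of_finite_dimensional[OF B(1) x(1)] one_in_V0 x(2) B(2) by auto
qed

lemma factorization_exists: "(a :: 'a) \<noteq> 0 \<Longrightarrow> \<not> nc_unit a \<Longrightarrow> factorizations a \<noteq> {}"
proof (induction "deg a" arbitrary: a rule: less_induct)
  case less
  show ?case
  proof (cases "nc_irreducible a")
    case True
    then have "[a] \<in> factorizations a" by (simp add: factorizations_def)
    then show ?thesis by blast
  next
    case False
    then obtain b c where bc: "\<not> nc_unit b" "\<not> nc_unit c" "a = b * c"
      using less.prems by (auto simp: nc_irreducible_def)
    then have nz: "b \<noteq> 0" "c \<noteq> 0" using less.prems by auto
    then have "deg b < deg a" "deg c < deg a"
      using deg_mult[of b c] deg_pos bc by auto
    then obtain bs cs where "bs \<in> factorizations b" "cs \<in> factorizations c"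
      using less.hyps nz bc by blast
    then have "bs @ cs \<in> factorizations a" by (auto simp: factorizations_def bc)
    then show ?thesis by blast
  qed
qed

section \<open>Factorizations up to scalars\<close>

definition proportional :: "'a \<Rightarrow> 'a \<Rightarrow> bool" where
  "proportional p q \<longleftrightarrow> (\<exists>r. r \<noteq> 0 \<and> p = scale r q)"

text \<open>Allowing \<open>scale r a\<close> in place of \<open>a\<close> makes the statement fit for induction: splitting off
  a first factor determines the remaining product only up to a scalar.\<close>

lemma finite_factorization_representatives:
  "a \<noteq> 0 \<Longrightarrow> \<exists>L. finite L \<and> (\<forall>as r. (\<forall>p\<in>set as. nc_irreducible p) \<longrightarrow> r \<noteq> 0 \<longrightarrow>
     prod_list as = scale r a \<longrightarrow> (\<exists>l\<in>L. list_all2 proportional as l))"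
proof (induction "deg a" arbitrary: a rule: less_induct)
  case less
  obtain B where B: "finite B" "V (deg a) = span B" by (rule V_span)
  obtain P where P: "finite P" "\<And>b c. (b, c) \<in> P \<Longrightarrow> b * c = a"
    "\<And>b c. b \<in> span B \<Longrightarrow> c \<in> span B \<Longrightarrow> b * c = a \<Longrightarrow>
      \<exists>(b', c')\<in>P. \<exists>r. r \<noteq> 0 \<and> b = scale r b' \<and> c' = scale r c"
    using finite_factor_pairs[OF B(1) less.prems] by blast
  \<comment> \<open>The degree condition sits inside so that \<open>L c\<close> is finite for every
    pair in \<open>P\<close>, also when \<open>c\<close> does not have smaller degree than
    \<open>a\<close>.\<close>
  have "\<exists>L. finite L \<and> (deg c < deg a \<longrightarrow> (\<forall>as r. (\<forall>p\<in>set as. nc_irreducible p) \<longrightarrow> r \<noteq> 0 \<longrightarrow>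
     prod_list as = scale r c \<longrightarrow> (\<exists>l\<in>L. list_all2 proportional as l)))" if "c \<noteq> 0" for c
    using less.hyps[OF _ that] by (cases "deg c < deg a") auto
  then obtain L where L: "\<And>c. c \<noteq> 0 \<Longrightarrow> finite (L c)"
    "\<And>c as r. c \<noteq> 0 \<Longrightarrow> deg c < deg a \<Longrightarrow> \<forall>p\<in>set as. nc_irreducible p \<Longrightarrow> r \<noteq> 0 \<Longrightarrow>
       prod_list as = scale r c \<Longrightarrow> \<exists>l\<in>L c. list_all2 proportional as l"
    by metis
  have Pnz: "c \<noteq> 0" if "(b, c) \<in> P" for b c
    using P(2)[OF that] less.prems by auto
  show ?case
  proof (intro exI conjI allI impI)
    show "finite (insert [] (\<Union>(b, c)\<in>P. (#) b ` L c))"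
      using P(1) L(1) Pnz by auto
    fix as r assume as: "\<forall>p\<in>set as. nc_irreducible p" and r: "r \<noteq> 0"
      and prod: "prod_list as = scale r a"
    show "\<exists>l\<in>insert [] (\<Union>(b, c)\<in>P. (#) b ` L c). list_all2 proportional as l"
    proof (cases as)
      case Nil
      then show ?thesis by simp
    next
      case (Cons p bs)
      define p' where "p' = scale (1 / r) p"
      define c where "c = prod_list bs"
      have p: "p \<noteq> 0" "deg p > 0" using as deg_pos by (auto simp: Cons nc_irreducible_def)
      have eq: "p' * c = a"
        using prod r by (simp add: p'_def c_def Cons scale_mult_left)
      then have "c \<noteq> 0" "p' \<noteq> 0" using less.prems by auto
      then have deg: "deg a = deg p + deg c"
        using deg_mult(2)[of p' c] eq r by (simp add: p'_def deg_scale)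
      then have "p' \<in> span B" "c \<in> span B"
        using in_V[of p' "deg a"] in_V[of c "deg a"] r B(2) by (auto simp: p'_def deg_scale)
      then obtain b' c' s where s: "(b', c') \<in> P" "s \<noteq> 0" "p' = scale s b'" "c' = scale s c"
        using P(3) eq by blast
      \<comment> \<open>Since \<open>deg p > 0\<close>, the remaining product has smaller degree;
        \<open>bs\<close> multiplies to a scalar multiple of \<open>c'\<close>, the form treated by
        the induction.\<close>
      have "deg c' < deg a" using s p deg by (simp add: deg_scale)
      moreover have "prod_list bs = scale (1 / s) c'" using s by (simp add: c_def)
      ultimately obtain l where l: "l \<in> L c'" "list_all2 proportional bs l"
        using L(2)[OF Pnz[OF s(1)], of bs "1 / s"] as s(2) by (auto simp: Cons)
      have "p = scale (r * s) b'"
        using s(3) r by (metis p'_def divide_inverse mult_1_left right_inverse scale_one scale_scale)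
      then have "proportional p b'" 
        using r s(2) unfolding proportional_def by (intro exI[of _ "r * s"]) auto
      then show ?thesis using l s(1) by (intro bexI[of _ "b' # l"]) (auto simp: Cons)
    qed
  qed
qed

text \<open>Nonzero scalars are central units, so two factorizations proportional to a common list
  are equivalent.\<close>

lemma proportional_trans_sym:
  assumes "proportional p l" "proportional q l"
  shows "\<exists>u. central_unit u \<and> q = u * p"
proof -
  obtain r s where rs: "r \<noteq> 0" "p = scale r l" "s \<noteq> 0" "q = scale s l"
    using assms by (auto simp: proportional_def)
  have "scale x 1 * scale y 1 = scale (x * y) 1" for x y
    by (simp add: scale_mult_left)
  then have "central_unit (scale (s / r) 1)"
    using rs unfolding central_unit_def nc_unit_def
    by (auto simp: scale_mult_left scale_mult_right intro!: exI[of _ "scale (r / s) 1"])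
  moreover have "q = scale (s / r) 1 * p" using rs by (simp add: scale_mult_left)
  ultimately show ?thesis by blast
qed

lemma finite_factorization_classes:
  assumes "(a :: 'a) \<noteq> 0"
  shows "finite (factorizations a // factorization_equiv a)"
proof -
  obtain L where L: "finite L" "\<And>as r. \<forall>p\<in>set as. nc_irreducible p \<Longrightarrow> r \<noteq> 0 \<Longrightarrow>
     prod_list as = scale r a \<Longrightarrow> \<exists>l\<in>L. list_all2 proportional as l"
    using finite_factorization_representatives[OF assms] by blast
  \<comment> \<open>The lists in \<open>L\<close> need not multiply to \<open>a\<close>;
    \<open>rep l\<close> is a genuine factorization proportional to \<open>l\<close>, if there is
    one, and every class is that of some \<open>rep l\<close>.\<close>
  define rep where "rep l = (SOME as. as \<in> factorizations a \<and> list_all2 proportional as l)" for l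
  have "factorizations a // factorization_equiv a \<subseteq> (\<lambda>l. factorization_equiv a `` {rep l}) ` L"
  proof
    fix X assume "X \<in> factorizations a // factorization_equiv a"
    then obtain as where as: "as \<in> factorizations a" "X = factorization_equiv a `` {as}"
      by (auto elim: quotientE)
    then obtain l where l: "l \<in> L" "list_all2 proportional as l"
      using L(2)[of as 1] by (auto simp: factorizations_def)
    have rep: "rep l \<in> factorizations a" "list_all2 proportional (rep l) l"
      using someI[of "\<lambda>as. as \<in> factorizations a \<and> list_all2 proportional as l", OF conjI, OF as(1) l(2)]
      by (auto simp: rep_def)
    have "list_all2 (\<lambda>p q. \<exists>u. central_unit u \<and> q = u * p) as (rep l)"
      using l(2) rep(2) proportional_trans_sym by (auto simp: list_all2_conv_all_nth)
    then have "(as, rep l) \<in> factorization_equiv a"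
      using as(1) rep(1) by (simp add: factorization_equiv_def)
    then have "X = factorization_equiv a `` {rep l}"
      unfolding as(2) by (rule equiv_class_eq[OF equiv_factorization_equiv])
    then show "X \<in> (\<lambda>l. factorization_equiv a `` {rep l}) ` L" using l(1) by blast
  qed
  then show ?thesis using L(1) finite_subset by blast
qed

end

theorem theorem1p1:
  fixes scale :: "'k::alg_closed_field \<Rightarrow> 'a::ring_1 \<Rightarrow> 'a"
  assumes "k_algebra scale"
    and "\<exists>V. finite_dim_filtration scale V \<and> nc_domain (assoc_graded V)"
  shows "finite_factorization_domain TYPE('a)"
proof -
  obtain V where "finite_dim_filtration scale V" "nc_domain (assoc_graded V)"
    using assms(2) by blast
  then interpret filtered_domain scale V
    using assms(1) by (simp add: filtered_domain_def filtered_domain_axioms_def)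
  show ?thesis
    using zero_product factorization_exists finite_factorization_classes
    by (auto simp: finite_factorization_domain_def)
qed

end
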